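(* Let $\mathbf{r}=(r_0,r_1)\in\mathbb{R}^2$. The mapping $\tau_{\mathbf{r}}$ has a nontrivial cycle whose elements all have the same sign if and only if $-2<r_0+r_1<0$. Thus, the set $\{(r_0,r_1)\in\mathbb{R}^2 : -2<r_0+r_1<0\}$ has empty intersection with $\mathcal{D}_2^{( * )}$. In particular, if $-1\le r_0+r_1<0$, then $(1)$ is a cycle of $\tau_{\mathbf{r}}$, and if $-2<r_0+r_1<-1$, then $(-1)$ is a cycle of $\tau_{\mathbf{r}}$.
   Context: For $\mathbf{r}=(r_0,r_1)\in\mathbb{R}^2$, the two-dimensional shift radix system is the map $\tau_{\mathbf{r}}:\mathbb{Z}^2\to\mathbb{Z}^2$, $\tau_{\mathbf{r}}(a_0,a_1)=(a_1,-\lfloor r_0a_0+r_1a_1\rfloor)$. The orbit of $(a_0,a_1)$ is identified with the integer sequence $(a_n)_{n\ge 0}$ where $a_{n+2}=-\lfloor r_0a_n+r_1a_{n+1}\rfloor$ for $n\ge0$. An orbit is ultimately periodic if there are $n_0\ge 0$, $p>0$ with $a_{n+p}=a_n$ for all $n\ge n_0$; in this case $(a_n,\ldots,a_{n+p-1})$ with $n\ge n_0$ is called a cycle of $\tau_{\mathbf{r}}$. The cycle $(0)$ is trivial, all other cycles are nontrivial. "All have the same sign" means all elements are strictly positive or all are strictly negative. $\mathcal{D}_2^{( * )}$ is the set of all $\mathbf{r}\in\mathbb{R}^2$ such that each ultimately periodic orbit of $\tau_{\mathbf{r}}$ ends up in the trivial cycle, i.e. satisfies $a_n=0$ for all sufficiently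 large $n$. *)

theory Defs
  imports Complex_Main
begin

definition srs_map :: "real \<times> real \<Rightarrow> int \<times> int \<Rightarrow> int \<times> int" where
  "srs_map r a = (snd a, - \<lfloor>fst r * of_int (fst a) + snd r * of_int (snd a)\<rfloor>)"

(* The orbit of a, identified with the integer sequence of first components;
   the lemmas below show that this is the sequence given by the recurrence. *)
definition srs_orbit :: "real \<times> real \<Rightarrow> int \<times> int \<Rightarrow> nat \<Rightarrow> int" where
  "srs_orbit r a n = fst ((srs_map r ^^ n) a)"

lemma srs_map_funpow: "(srs_map r ^^ n) a = (srs_orbit r a n, srs_orbit r a (Suc n))"
  by (simp add: srs_orbit_def srs_map_def)

lemma srs_orbit_0: "srs_orbit r (a0, a1) 0 = a0"
  by (simp add: srs_orbit_def)

lemma srs_orbit_1: "srs_orbit r (a0, a1) (Suc 0) = a1"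
  by (simp add: srs_orbit_def srs_map_def)

lemma srs_orbit_rec:
  "srs_orbit (r0, r1) a (n + 2) =
     - \<lfloor>r0 * of_int (srs_orbit (r0, r1) a n) + r1 * of_int (srs_orbit (r0, r1) a (n + 1))\<rfloor>"
  by (simp add: srs_orbit_def srs_map_def)

definition periodic_from :: "(nat \<Rightarrow> int) \<Rightarrow> nat \<Rightarrow> nat \<Rightarrow> bool" where
  "periodic_from s n0 p \<longleftrightarrow> p > 0 \<and> (\<forall>n\<ge>n0. s (n + p) = s n)"

definition ultimately_periodic :: "(nat \<Rightarrow> int) \<Rightarrow> bool" where
  "ultimately_periodic s \<longleftrightarrow> (\<exists>n0 p. periodic_from s n0 p)"

definition srs_cycle :: "real \<times> real \<Rightarrow> int list \<Rightarrow> bool" where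
  "srs_cycle r c \<longleftrightarrow>
     (\<exists>a n0 p n. periodic_from (srs_orbit r a) n0 p \<and> n \<ge> n0 \<and>
        c = map (srs_orbit r a) [n..<n + p])"

(* The period p of a cycle need not be minimal, so every list [0, ..., 0]
   represents the trivial cycle (0). *)
definition trivial_cycle :: "int list \<Rightarrow> bool" where
  "trivial_cycle c \<longleftrightarrow> set c = {0}"

definition all_same_sign :: "int list \<Rightarrow> bool" where
  "all_same_sign c \<longleftrightarrow> (\<forall>x\<in>set c. x > 0) \<or> (\<forall>x\<in>set c. x < 0)"

definition D2_star :: "(real \<times> real) set" where
  "D2_star = {r. \<forall>a. ultimately_periodic (srs_orbit r a) \<longrightarrow>
                    (\<exists>N. \<forall>n\<ge>N. srs_orbit r a n = 0)}"

end

theory Submission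
  imports Defs
begin

text \<open>
  The recurrence says that \<open>0 \<le> r0 a(n) + r1 a(n+1) + a(n+2) < 1\<close>. Summing over a period of
  length \<open>p\<close> gives \<open>0 \<le> (r0 + r1 + 1) A < p\<close>, where \<open>A\<close> is the sum over the cycle. If
  all elements have the same sign then \<open>\<bar>A\<bar> \<ge> p\<close>, because they are nonzero integers.
\<close>

text \<open>Since a(k+2) is minus the floor of r0 a(k) + r1 a(k+1), the bounded expression is the
  fractional part of that number.\<close>

lemma srs_orbit_bounds:
  fixes r0 r1 :: real
  defines "a \<equiv> \<lambda>x k. of_int (srs_orbit (r0, r1) x k) :: real"
  shows "0 \<le> r0 * a x k + r1 * a x (Suc k) + a x (Suc (Suc k))"
    and "r0 * a x k + r1 * a x (Suc k) + a x (Suc (Suc k)) < 1"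
  using srs_orbit_rec[of r0 r1 x k] unfolding a_def by (simp_all, linarith+)

text \<open>The difference of the two sums telescopes to \<open>f (n + p) - f n\<close>, which
  vanishes.\<close>

lemma sum_Suc_periodic:
  fixes f :: "nat \<Rightarrow> 'a :: ab_group_add"
  assumes "f (n + p) = f n"
  shows "(\<Sum>k\<in>{n..<n+p}. f (Suc k)) = (\<Sum>k\<in>{n..<n+p}. f k)"
proof -
  have "(\<Sum>k\<in>{n..<n+p}. f (Suc k) - f k) = 0"
    using assms by (simp add: sum_Suc_diff')
  then show ?thesis by (simp add: sum_subtractf)
qed

lemma periodic_orbit_sum_bounds:
  fixes r0 r1 :: real
  assumes "periodic_from (srs_orbit (r0, r1) x) n0 p" and "n \<ge> n0"
  defines "A \<equiv> \<Sum>k\<in>{n..<n+p}. real_of_int (srs_orbit (r0, r1) x k)"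
  shows "0 \<le> (r0 + r1 + 1) * A" and "(r0 + r1 + 1) * A < real p"
proof -
  define a where "a = (\<lambda>k. real_of_int (srs_orbit (r0, r1) x k))"
  define b where "b k = r0 * a k + r1 * a (Suc k) + a (Suc (Suc k))" for k
  have p: "p > 0" and per: "\<And>k. k \<ge> n0 \<Longrightarrow> a (k + p) = a k"
    using assms(1) by (auto simp: periodic_from_def a_def)
  have shift1: "(\<Sum>k\<in>{n..<n+p}. a (Suc k)) = A"
    using sum_Suc_periodic[of a n p] per \<open>n \<ge> n0\<close> by (simp add: A_def a_def)
  have shift2: "(\<Sum>k\<in>{n..<n+p}. a (Suc (Suc k))) = A"
    \<comment> \<open>The second shift applies the lemma to the already shifted sequence, so its
      endpoint condition is periodicity at \<open>Suc n\<close>.\<close>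
    using sum_Suc_periodic[of "\<lambda>k. a (Suc k)" n p] per[of "Suc n"] \<open>n \<ge> n0\<close> shift1 by simp
  have "(\<Sum>k\<in>{n..<n+p}. b k) = r0 * A + r1 * A + A"
    using shift1 shift2
    by (simp add: b_def sum.distrib flip: sum_distrib_left) (simp add: A_def a_def)
  then have sum_b: "(\<Sum>k\<in>{n..<n+p}. b k) = (r0 + r1 + 1) * A"
    by (simp add: algebra_simps)
  have b: "0 \<le> b k" "b k < 1" for k
    using srs_orbit_bounds[of r0 r1 x k] by (simp_all add: a_def b_def)
  show "0 \<le> (r0 + r1 + 1) * A"
    using b unfolding sum_b[symmetric] by (simp add: sum_nonneg)
  \<comment> \<open>The inequality between the sums is strict because \<open>p > 0\<close> makes the
    window nonempty.\<close>
  have "(\<Sum>k\<in>{n..<n+p}. b k) < (\<Sum>k\<in>{n..<n+p}. 1)"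
    using b p by (intro sum_strict_mono) auto
  then show "(r0 + r1 + 1) * A < real p"
    by (simp add: sum_b)
qed

text \<open>A positive cycle forces -1 \<le> r0 + r1 < 0 and a negative one -2 < r0 + r1 \<le> -1;
  the conclusion is the union of the two ranges.\<close>

lemma same_sign_cycle_bounds:
  fixes r0 r1 :: real
  assumes "srs_cycle (r0, r1) c" and "all_same_sign c"
  shows "-2 < r0 + r1 \<and> r0 + r1 < 0"
proof -
  obtain x n0 p n where per: "periodic_from (srs_orbit (r0, r1) x) n0 p" "n \<ge> n0"
    and c: "c = map (srs_orbit (r0, r1) x) [n..<n + p]"
    using assms(1) unfolding srs_cycle_def by blast
  define A where "A = (\<Sum>k\<in>{n..<n+p}. real_of_int (srs_orbit (r0, r1) x k))"
  have p: "p > 0" using per(1) by (simp add: periodic_from_def)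
  have A: "0 \<le> (r0 + r1 + 1) * A" "(r0 + r1 + 1) * A < p"
    unfolding A_def using periodic_orbit_sum_bounds[OF per] by auto
  consider "\<forall>k\<in>{n..<n+p}. 0 < srs_orbit (r0, r1) x k"
    | "\<forall>k\<in>{n..<n+p}. srs_orbit (r0, r1) x k < 0"
    using assms(2) by (auto simp: all_same_sign_def c)
  then show ?thesis
  proof cases
    case 1
    have "(\<Sum>k\<in>{n..<n+p}. (1::real)) \<le> A"
      unfolding A_def using 1 by (intro sum_mono) force
    then have ge: "real p \<le> A" by simp
    then have "A > 0" using p by linarith
    have "0 \<le> r0 + r1 + 1"
      using A(1) \<open>A > 0\<close> by (simp add: zero_le_mult_iff)
    moreover have "(r0 + r1 + 1) * A < 1 * A" using A(2) ge by linarith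
    then have "r0 + r1 + 1 < 1" using \<open>A > 0\<close> mult_less_cancel_right_pos by blast
    ultimately show ?thesis by linarith
  next
    case 2
    have "A \<le> (\<Sum>k\<in>{n..<n+p}. (-1::real))"
      unfolding A_def using 2 by (intro sum_mono) force
    then have le: "A \<le> - real p" by simp
    then have "A < 0" using p by linarith
    have "r0 + r1 + 1 \<le> 0"
      using A(1) \<open>A < 0\<close> by (simp add: zero_le_mult_iff)
    \<comment> \<open>Here \<open>real p \<le> - A\<close> turns the upper bound into a comparison
      of multiples of \<open>A\<close>; cancelling the negative \<open>A\<close> then reverses the
      inequality.\<close>
    moreover have "(r0 + r1 + 1) * A < (-1) * A" using A(2) le by linarith
    then have "-1 < r0 + r1 + 1" using \<open>A < 0\<close> mult_less_cancel_right_neg by blast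
    ultimately show ?thesis by linarith
  qed
qed

lemma srs_orbit_fixed_point:
  assumes "srs_map r (m, m) = (m, m)"
  shows "srs_orbit r (m, m) k = m"
proof -
  have "(srs_map r ^^ k) (m, m) = (m, m)"
    by (induction k) (simp_all add: assms)
  then show ?thesis by (simp add: srs_orbit_def)
qed

lemma srs_cycle_fixed_point:
  assumes "srs_map r (m, m) = (m, m)"
  shows "srs_cycle r [m]"
proof -
  have "periodic_from (srs_orbit r (m, m)) 0 1"
    by (simp add: periodic_from_def srs_orbit_fixed_point[OF assms])
  \<comment> \<open>The bound \<open>0 + 1\<close> matches the pattern \<open>[n..<n + p]\<close> at
    \<open>n = 0\<close>, \<open>p = 1\<close>.\<close>
  moreover have "[m] = map (srs_orbit r (m, m)) [0..<0 + 1]"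
    by (simp add: srs_orbit_fixed_point[OF assms])
  ultimately show ?thesis unfolding srs_cycle_def by (metis order_refl)
qed

text \<open>The orbit of \<open>(m, m)\<close> is constantly \<open>m\<close>, hence periodic
  without ever reaching 0.\<close>

lemma fixed_point_notin_D2_star:
  assumes "srs_map r (m, m) = (m, m)" and "m \<noteq> 0"
  shows "r \<notin> D2_star"
proof -
  note orbit = srs_orbit_fixed_point[OF assms(1)]
  have "periodic_from (srs_orbit r (m, m)) 0 1"
    by (simp add: periodic_from_def orbit)
  then have "ultimately_periodic (srs_orbit r (m, m))"
    unfolding ultimately_periodic_def by blast
  moreover have "\<not> (\<exists>N. \<forall>n\<ge>N. srs_orbit r (m, m) n = 0)"
    using assms(2) by (auto simp: orbit)
  ultimately show ?thesis unfolding D2_star_def by blast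
qed

lemma srs_map_one:
  fixes r0 r1 :: real
  assumes "-1 \<le> r0 + r1" "r0 + r1 < 0"
  shows "srs_map (r0, r1) (1, 1) = (1, 1)"
proof -
  have "\<lfloor>r0 + r1\<rfloor> = -1" using assms by linarith
  then show ?thesis by (simp add: srs_map_def)
qed

lemma srs_map_minus_one:
  fixes r0 r1 :: real
  assumes "-2 < r0 + r1" "r0 + r1 \<le> -1"
  shows "srs_map (r0, r1) (-1, -1) = (-1, -1)"
proof -
  have "\<lfloor>- r0 - r1\<rfloor> = 1" using assms by linarith
  then show ?thesis by (simp add: srs_map_def)
qed

text \<open>The strip splits at r0 + r1 = -1, with \<open>1\<close> as the witness on and above that
  line and \<open>-1\<close> below it. This serves both the converse of the equivalence and the
  disjointness from \<open>D2_star\<close>.\<close>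

lemma srs_fixed_point_exists:
  fixes r0 r1 :: real
  assumes "-2 < r0 + r1" "r0 + r1 < 0"
  obtains m where "m \<noteq> 0" "srs_map (r0, r1) (m, m) = (m, m)"
proof (cases "-1 \<le> r0 + r1")
  case True
  then show ?thesis using that[of 1] srs_map_one assms by simp
next
  case False
  then show ?thesis using that[of "-1"] srs_map_minus_one assms by simp
qed

theorem lemma2:
  fixes r0 r1 :: real
  shows "((\<exists>c. srs_cycle (r0, r1) c \<and> \<not> trivial_cycle c \<and> all_same_sign c)
            \<longleftrightarrow> -2 < r0 + r1 \<and> r0 + r1 < 0)
       \<and> {(s0 :: real, s1 :: real). -2 < s0 + s1 \<and> s0 + s1 < 0} \<inter> D2_star = {}
       \<and> (-1 \<le> r0 + r1 \<and> r0 + r1 < 0 \<longrightarrow> srs_cycle (r0, r1) [1])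
       \<and> (-2 < r0 + r1 \<and> r0 + r1 < -1 \<longrightarrow> srs_cycle (r0, r1) [-1])"
proof (intro conjI)
  have "\<exists>c. srs_cycle (r0, r1) c \<and> \<not> trivial_cycle c \<and> all_same_sign c"
    if s: "-2 < r0 + r1" "r0 + r1 < 0"
  proof -
    obtain m where "m \<noteq> 0" "srs_map (r0, r1) (m, m) = (m, m)"
      using srs_fixed_point_exists[OF s] .
    then show ?thesis
      \<comment> \<open>A one-element cycle has constant sign as soon as its entry is
        nonzero.\<close>
      by (intro exI[of _ "[m]"])
        (auto simp: srs_cycle_fixed_point trivial_cycle_def all_same_sign_def)
  qed
  then show "(\<exists>c. srs_cycle (r0, r1) c \<and> \<not> trivial_cycle c \<and> all_same_sign c)
      \<longleftrightarrow> -2 < r0 + r1 \<and> r0 + r1 < 0"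
    using same_sign_cycle_bounds by blast
  show "{(s0 :: real, s1 :: real). -2 < s0 + s1 \<and> s0 + s1 < 0} \<inter> D2_star = {}"
    using fixed_point_notin_D2_star srs_fixed_point_exists by (auto, metis)
  show "-1 \<le> r0 + r1 \<and> r0 + r1 < 0 \<longrightarrow> srs_cycle (r0, r1) [1]"
    by (simp add: srs_map_one srs_cycle_fixed_point)
  show "-2 < r0 + r1 \<and> r0 + r1 < -1 \<longrightarrow> srs_cycle (r0, r1) [-1]"
    by (simp add: srs_map_minus_one srs_cycle_fixed_point)
qed

end
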